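(* The assignment $G \mapsto \mathfrak{W}G$ (the walk groupoid) on graphs, together with the assignment to each graph morphism $\phi: G \to H$ of the map $\phi_*: \mathfrak{W}G \to \mathfrak{W}H$ given by $\phi_*(v)=\phi(v)$ on objects and $\phi_*[(v_0v_1\dots v_n)] = [(\phi(v_0)\phi(v_1)\dots\phi(v_n))]$ on arrows, defines a functor from the category $\mathsf{Gph}$ of graphs to the category $\mathsf{Groupoids}$ of groupoids.
   Context: A graph $G$ is undirected without multiple edges, loops allowed: a vertex set $V(G)$ with a symmetric adjacency relation $\sim$ (edges). A graph morphism $f: G\to H$ is a map $V(G)\to V(H)$ with $v_1\sim v_2 \Rightarrow f(v_1)\sim f(v_2)$. These form the category $\mathsf{Gph}$. A walk of length $n\ge 0$ in $G$ from $v_0$ to $v_n$ is a sequence $(v_0v_1\dots v_n)$ of vertices with $v_i\sim v_{i+1}$ for all $i$. Concatenation of a walk $(x v_1\dots v_{n-1}y)$ with a walk $(y w_1\dots w_{m-1}z)$ is $(x v_1\dots v_{n-1}y w_1\dots w_{m-1}z)$. A walk $(v_0\dots v_n)$ is prunable if $v_i=v_{i+2}$ for some $i$; the corresponding prune is the walk obtained by deleting the entries $v_i$ and $v_{i+1}$. Two walks are prune equivalent if they are related by the equivalence relation generated by prunes; equivalence classes are called prune classes. The walk groupoid $\mathfrak{W}G$ has as objects the vertices of $G$, as arrows from $v$ to $w$ the prune classes of walks from $v$ to $w$, composition induced by concatenation, identities the length-$0$ walks, and inverses given by reversing walks. *)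

theory Defs
  imports "Graph_Theory.Graph_Theory" "HOL-Library.FuncSet"
begin

section \<open>Categories, groupoids and functors\<close>

text \<open>
  All structure is required to be \<^const>\<open>undefined\<close> outside its carriers. Hence two categories
  (and likewise two functors between fixed categories) are equal as HOL values exactly if they have
  the same objects, arrows and operations. Composition is written in the order of functions:
  \<open>Comp C g f\<close> is \<open>g\<close> after \<open>f\<close>.
\<close>

record ('o, 'm) category_data =
  Obj :: "'o set"
  Arr :: "'m set"
  Dom :: "'m \<Rightarrow> 'o"
  Cod :: "'m \<Rightarrow> 'o"
  Id :: "'o \<Rightarrow> 'm"
  Comp :: "'m \<Rightarrow> 'm \<Rightarrow> 'm"

definition composable :: "'m set \<Rightarrow> ('m \<Rightarrow> 'o) \<Rightarrow> ('m \<Rightarrow> 'o) \<Rightarrow> 'm \<Rightarrow> 'm \<Rightarrow> bool" where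
  "composable A dm cd g f \<longleftrightarrow> g \<in> A \<and> f \<in> A \<and> dm g = cd f"

locale category =
  fixes C :: "('o, 'm) category_data"
  assumes Dom: "Dom C \<in> Arr C \<rightarrow>\<^sub>E Obj C"
    and Cod: "Cod C \<in> Arr C \<rightarrow>\<^sub>E Obj C"
    and Id: "Id C \<in> Obj C \<rightarrow>\<^sub>E Arr C"
    and Dom_Id: "x \<in> Obj C \<Longrightarrow> Dom C (Id C x) = x"
    and Cod_Id: "x \<in> Obj C \<Longrightarrow> Cod C (Id C x) = x"
    and Comp_in_Arr: "composable (Arr C) (Dom C) (Cod C) g f \<Longrightarrow> Comp C g f \<in> Arr C"
    and Dom_Comp: "composable (Arr C) (Dom C) (Cod C) g f \<Longrightarrow> Dom C (Comp C g f) = Dom C f"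
    and Cod_Comp: "composable (Arr C) (Dom C) (Cod C) g f \<Longrightarrow> Cod C (Comp C g f) = Cod C g"
    and Comp_undefined: "\<not> composable (Arr C) (Dom C) (Cod C) g f \<Longrightarrow> Comp C g f = undefined"
    and Comp_Id: "f \<in> Arr C \<Longrightarrow> Comp C f (Id C (Dom C f)) = f"
    and Id_Comp: "f \<in> Arr C \<Longrightarrow> Comp C (Id C (Cod C f)) f = f"
    and Comp_assoc: "composable (Arr C) (Dom C) (Cod C) g f \<Longrightarrow>
      composable (Arr C) (Dom C) (Cod C) h g \<Longrightarrow>
      Comp C h (Comp C g f) = Comp C (Comp C h g) f"

locale groupoid = category C for C :: "('o, 'm) category_data" +
  assumes invertible: "f \<in> Arr C \<Longrightarrow>
    \<exists>g\<in>Arr C. Dom C g = Cod C f \<and> Cod C g = Dom C f \<and>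
      Comp C g f = Id C (Dom C f) \<and> Comp C f g = Id C (Cod C f)"

record ('o, 'm, 'p, 'n) functor_data =
  on_obj :: "'o \<Rightarrow> 'p"
  on_arr :: "'m \<Rightarrow> 'n"

locale category_functor = source: category C + target: category D
  for C :: "('o, 'm) category_data" and D :: "('p, 'n) category_data" +
  fixes F :: "('o, 'm, 'p, 'n) functor_data"
  assumes on_obj: "on_obj F \<in> Obj C \<rightarrow>\<^sub>E Obj D"
    and on_arr: "on_arr F \<in> Arr C \<rightarrow>\<^sub>E Arr D"
    and Dom_on_arr: "f \<in> Arr C \<Longrightarrow> Dom D (on_arr F f) = on_obj F (Dom C f)"
    and Cod_on_arr: "f \<in> Arr C \<Longrightarrow> Cod D (on_arr F f) = on_obj F (Cod C f)"
    and on_arr_Id: "x \<in> Obj C \<Longrightarrow> on_arr F (Id C x) = Id D (on_obj F x)"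
    and on_arr_Comp: "composable (Arr C) (Dom C) (Cod C) g f \<Longrightarrow>
      on_arr F (Comp C g f) = Comp D (on_arr F g) (on_arr F f)"

text \<open>
  In the categories below an arrow carries its source and target along with the underlying map.
  In \<open>maps_category X hom i c\<close>, the map \<open>c x g f\<close> is \<open>g\<close> after \<open>f\<close>, where \<open>x\<close> is the source of \<open>f\<close>.
\<close>

datatype ('x, 'f) arrow = Arrow (source: 'x) (underlying: 'f) (target: 'x)

definition maps_category ::
  "'x set \<Rightarrow> ('x \<Rightarrow> 'x \<Rightarrow> 'f set) \<Rightarrow> ('x \<Rightarrow> 'f) \<Rightarrow> ('x \<Rightarrow> 'f \<Rightarrow> 'f \<Rightarrow> 'f) \<Rightarrow>
    ('x, ('x, 'f) arrow) category_data" where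
  "maps_category X hom i c =
    (let A = {Arrow x f y | x f y. x \<in> X \<and> y \<in> X \<and> f \<in> hom x y} in
      \<lparr> Obj = X, Arr = A, Dom = restrict source A, Cod = restrict target A,
        Id = (\<lambda>x\<in>X. Arrow x (i x) x),
        Comp = (\<lambda>g f. if composable A source target g f
          then Arrow (source f) (c (source f) (underlying g) (underlying f)) (target g)
          else undefined) \<rparr>)"

definition id_functor :: "('o, 'm) category_data \<Rightarrow> ('o, 'm, 'o, 'm) functor_data" where
  "id_functor C = \<lparr> on_obj = (\<lambda>x\<in>Obj C. x), on_arr = (\<lambda>f\<in>Arr C. f) \<rparr>"

definition comp_functor :: "('o, 'm) category_data \<Rightarrow> ('p, 'n, 'q, 'r) functor_data \<Rightarrow>
    ('o, 'm, 'p, 'n) functor_data \<Rightarrow> ('o, 'm, 'q, 'r) functor_data" where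
  "comp_functor C F' F =
    \<lparr> on_obj = compose (Obj C) (on_obj F') (on_obj F),
      on_arr = compose (Arr C) (on_arr F') (on_arr F) \<rparr>"

definition Groupoids :: "(('o, 'm) category_data,
    (('o, 'm) category_data, ('o, 'm, 'o, 'm) functor_data) arrow) category_data" where
  "Groupoids = maps_category (Collect groupoid) (\<lambda>C D. Collect (category_functor C D))
    id_functor comp_functor"

section \<open>The category of graphs\<close>

text \<open>
  An undirected graph without multiple edges, possibly with loops and possibly infinite, is a
  \<^locale>\<open>pair_sym_digraph\<close>: a vertex set \<^const>\<open>pverts\<close> with a symmetric relation \<^const>\<open>parcs\<close> on it.
\<close>

definition graph_morphisms :: "'a pair_pre_digraph \<Rightarrow> 'a pair_pre_digraph \<Rightarrow> ('a \<Rightarrow> 'a) set" where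
  "graph_morphisms G H =
    {f \<in> pverts G \<rightarrow>\<^sub>E pverts H. \<forall>u v. (u, v) \<in> parcs G \<longrightarrow> (f u, f v) \<in> parcs H}"

definition Gph :: "('a pair_pre_digraph, ('a pair_pre_digraph, 'a \<Rightarrow> 'a) arrow) category_data" where
  "Gph = maps_category (Collect pair_sym_digraph) graph_morphisms
    (\<lambda>G. \<lambda>v\<in>pverts G. v) (\<lambda>G. compose (pverts G))"

section \<open>The walk groupoid\<close>

text \<open>
  Walks are the nonempty vertex lists satisfying \<^const>\<open>vwalk\<close>; a walk of length \<open>n\<close> has
  \<open>n + 1\<close> entries. The arc relation of a \<open>pair_pre_digraph\<close> is seen by \<^const>\<open>vwalk\<close>
  through \<^const>\<open>with_proj\<close>.
\<close>

inductive prune :: "'a pair_pre_digraph \<Rightarrow> 'a list \<Rightarrow> 'a list \<Rightarrow> bool" for G where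
  "vwalk (xs @ u # v # u # ys) (with_proj G) \<Longrightarrow> prune G (xs @ u # v # u # ys) (xs @ u # ys)"

definition prune_class :: "'a pair_pre_digraph \<Rightarrow> 'a list \<Rightarrow> 'a list set" where
  "prune_class G p = {q. equivclp (prune G) p q}"

definition prune_classes :: "'a pair_pre_digraph \<Rightarrow> 'a list set set" where
  "prune_classes G = prune_class G ` {p. vwalk p (with_proj G)}"

text \<open>
  The first and the last vertex are constant on a prune class. Operations on classes are unions
  over all representatives; such a union is again a prune class only if the operation does not
  depend on the representatives.
\<close>

definition class_start :: "'a list set \<Rightarrow> 'a" where
  "class_start c = the_elem (hd ` c)"

definition class_end :: "'a list set \<Rightarrow> 'a" where
  "class_end c = the_elem (last ` c)"

text \<open>\<open>Comp d c\<close> is the class of the walk that first follows \<open>c\<close> and then \<open>d\<close>.\<close>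

definition walk_groupoid :: "'a pair_pre_digraph \<Rightarrow> ('a, 'a list set) category_data" where
  "walk_groupoid G =
    \<lparr> Obj = pverts G, Arr = prune_classes G,
      Dom = restrict class_start (prune_classes G), Cod = restrict class_end (prune_classes G),
      Id = (\<lambda>v\<in>pverts G. prune_class G [v]),
      Comp = (\<lambda>d c. if composable (prune_classes G) class_start class_end d c
        then \<Union>p\<in>c. \<Union>q\<in>d. prune_class G (vwalk_join p q) else undefined) \<rparr>"

definition induced_map :: "'a pair_pre_digraph \<Rightarrow> 'a pair_pre_digraph \<Rightarrow> ('a \<Rightarrow> 'a) \<Rightarrow>
    ('a, 'a list set, 'a, 'a list set) functor_data" where
  "induced_map G H \<phi> =
    \<lparr> on_obj = (\<lambda>v\<in>pverts G. \<phi> v),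
      on_arr = (\<lambda>c\<in>prune_classes G. \<Union>p\<in>c. prune_class H (map \<phi> p)) \<rparr>"

definition walk_groupoid_functor ::
  "('a pair_pre_digraph, ('a pair_pre_digraph, 'a \<Rightarrow> 'a) arrow, ('a, 'a list set) category_data,
    (('a, 'a list set) category_data, ('a, 'a list set, 'a, 'a list set) functor_data) arrow)
    functor_data" where
  "walk_groupoid_functor =
    \<lparr> on_obj = (\<lambda>G\<in>Obj Gph. walk_groupoid G),
      on_arr = (\<lambda>f\<in>Arr Gph. Arrow (walk_groupoid (source f))
        (induced_map (source f) (target f) (underlying f)) (walk_groupoid (target f))) \<rparr>"

end

theory Submission
  imports Defs
begin

text \<open>
  Concatenation and the pointwise image under a graph morphism carry prunes to prunes, so both
  descend to prune classes; the class of \<open>rev p\<close> inverts that of \<open>p\<close> because the turning point of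
  \<open>p \<oplus> rev p\<close> can be pruned away repeatedly. Two functors out of a walk groupoid are equal as soon
  as they agree on vertices and on classes of walks, which yields functoriality.
\<close>

section \<open>Categories of structured maps\<close>

lemma Arrow_in_maps_category [simp]:
  "Arrow x f y \<in> Arr (maps_category X hom i c) \<longleftrightarrow> x \<in> X \<and> y \<in> X \<and> f \<in> hom x y"
  by (auto simp: maps_category_def Let_def)

lemma Arr_maps_categoryE:
  assumes "a \<in> Arr (maps_category X hom i c)"
  obtains x f y where "a = Arrow x f y" "x \<in> X" "y \<in> X" "f \<in> hom x y"
  using assms by (auto simp: maps_category_def Let_def)

lemma maps_category_simps [simp]:
  "Obj (maps_category X hom i c) = X"
  "x \<in> X \<Longrightarrow> Id (maps_category X hom i c) x = Arrow x (i x) x"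
  "Arrow x f y \<in> Arr (maps_category X hom i c) \<Longrightarrow>
    Dom (maps_category X hom i c) (Arrow x f y) = x"
  "Arrow x f y \<in> Arr (maps_category X hom i c) \<Longrightarrow>
    Cod (maps_category X hom i c) (Arrow x f y) = y"
  "Arrow x f y \<in> Arr (maps_category X hom i c) \<Longrightarrow> Arrow y g z \<in> Arr (maps_category X hom i c) \<Longrightarrow>
    Comp (maps_category X hom i c) (Arrow y g z) (Arrow x f y) = Arrow x (c x g f) z"
  by (auto simp: maps_category_def Let_def composable_def)

text \<open>Turns abstract composability into explicit triples that share the middle object, the
  shape on which \<open>maps_category_simps\<close> compute.\<close>

lemma composable_maps_categoryE:
  fixes X hom i c
  defines "C \<equiv> maps_category X hom i c"
  assumes "composable (Arr C) (Dom C) (Cod C) b a"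
  obtains x f y g z where "a = Arrow x f y" "b = Arrow y g z" "x \<in> X" "y \<in> X" "z \<in> X"
    "f \<in> hom x y" "g \<in> hom y z"
  using assms unfolding composable_def by (auto elim!: Arr_maps_categoryE)

text \<open>Carriers, endpoints and the default value of \<open>Comp\<close> are right by
  construction, so only closure, unit and associativity laws for the underlying maps remain. Both
  \<open>Groupoids\<close> and \<open>Gph\<close> arise this way.\<close>

lemma category_maps_category:
  assumes id: "\<And>x. x \<in> X \<Longrightarrow> i x \<in> hom x x"
    and comp: "\<And>x y z f g. x \<in> X \<Longrightarrow> y \<in> X \<Longrightarrow> z \<in> X \<Longrightarrow> f \<in> hom x y \<Longrightarrow> g \<in> hom y z \<Longrightarrow>
      c x g f \<in> hom x z"
    and comp_id: "\<And>x y f. x \<in> X \<Longrightarrow> y \<in> X \<Longrightarrow> f \<in> hom x y \<Longrightarrow> c x f (i x) = f"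
    and id_comp: "\<And>x y f. x \<in> X \<Longrightarrow> y \<in> X \<Longrightarrow> f \<in> hom x y \<Longrightarrow> c x (i y) f = f"
    and assoc: "\<And>x y z w f g h. x \<in> X \<Longrightarrow> y \<in> X \<Longrightarrow> z \<in> X \<Longrightarrow> w \<in> X \<Longrightarrow>
      f \<in> hom x y \<Longrightarrow> g \<in> hom y z \<Longrightarrow> h \<in> hom z w \<Longrightarrow> c x h (c x g f) = c x (c y h g) f"
  shows "category (maps_category X hom i c)" (is "category ?C")
proof
  show "Dom ?C \<in> Arr ?C \<rightarrow>\<^sub>E Obj ?C" "Cod ?C \<in> Arr ?C \<rightarrow>\<^sub>E Obj ?C"
    by (auto simp: maps_category_def Let_def)
  show "Id ?C \<in> Obj ?C \<rightarrow>\<^sub>E Arr ?C"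
    using id by (auto simp: maps_category_def Let_def)
next
  fix a b assume "\<not> composable (Arr ?C) (Dom ?C) (Cod ?C) b a"
  then show "Comp ?C b a = undefined"
    by (auto simp: maps_category_def Let_def composable_def)
next
  fix a b d
  assume "composable (Arr ?C) (Dom ?C) (Cod ?C) b a" "composable (Arr ?C) (Dom ?C) (Cod ?C) d b"
  then show "Comp ?C d (Comp ?C b a) = Comp ?C (Comp ?C d b) a"
    by (auto elim!: composable_maps_categoryE simp: comp assoc)
qed (auto elim!: composable_maps_categoryE Arr_maps_categoryE simp: id comp comp_id id_comp)

section \<open>Identity and composite functors\<close>

lemma (in category_functor) on_obj_in: "x \<in> Obj C \<Longrightarrow> on_obj F x \<in> Obj D"
  and on_arr_in: "f \<in> Arr C \<Longrightarrow> on_arr F f \<in> Arr D"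
  using on_obj on_arr by auto

lemma (in category) Id_in: "x \<in> Obj C \<Longrightarrow> Id C x \<in> Arr C"
  and Dom_in: "f \<in> Arr C \<Longrightarrow> Dom C f \<in> Obj C"
  and Cod_in: "f \<in> Arr C \<Longrightarrow> Cod C f \<in> Obj C"
  using Id Dom Cod by auto

lemma category_functor_id_functor:
  assumes "category C"
  shows "category_functor C C (id_functor C)"
proof -
  interpret category C by fact
  show ?thesis
    by unfold_locales
      (auto simp: id_functor_def Id_in Dom_in Cod_in Comp_in_Arr composable_def)
qed

lemma category_functor_comp_functor:
  assumes "category_functor C D F" "category_functor D E F'"
  shows "category_functor C E (comp_functor C F' F)"
proof -
  interpret F: category_functor C D F by fact
  interpret F': category_functor D E F' by fact
  show ?thesis
  proof
    fix g f assume gf: "composable (Arr C) (Dom C) (Cod C) g f"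
    \<comment> \<open>\<open>F\<close> preserves endpoints, so the images stay composable and
      \<open>F'\<close> can be applied to their composite.\<close>
    then have "composable (Arr D) (Dom D) (Cod D) (on_arr F g) (on_arr F f)"
      by (simp add: composable_def F.Dom_on_arr F.Cod_on_arr F.on_arr_in)
    with gf show "on_arr (comp_functor C F' F) (Comp C g f) =
        Comp E (on_arr (comp_functor C F' F) g) (on_arr (comp_functor C F' F) f)"
      using F.source.Comp_in_Arr [OF gf]
      by (simp add: comp_functor_def compose_eq composable_def F.on_arr_Comp F'.on_arr_Comp)
  qed (auto simp: comp_functor_def compose_eq PiE_iff F.on_arr_in F.on_obj_in F'.on_arr_in F'.on_obj_in
      F.Dom_on_arr F.Cod_on_arr F'.Dom_on_arr F'.Cod_on_arr F.on_arr_Id F'.on_arr_Id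
      F.source.Id_in F.source.Dom_in F.source.Cod_in)
qed

section \<open>The two concrete categories\<close>

lemma category_Groupoids: "category Groupoids"
  unfolding Groupoids_def
proof (rule category_maps_category; clarsimp)
  fix C :: "('o, 'm) category_data" assume "groupoid C"
  then show "category_functor C C (id_functor C)"
    by (intro category_functor_id_functor groupoid.axioms)
next
  fix C D E :: "('o, 'm) category_data" and F F'
  assume "category_functor C D F" "category_functor D E F'"
  then show "category_functor C E (comp_functor C F' F)"
    by (rule category_functor_comp_functor)
next
  fix C D :: "('o, 'm) category_data" and F assume "category_functor C D F"
  then interpret category_functor C D F .
  \<comment> \<open>The unit laws are equalities of HOL values: \<open>F\<close> is
    \<open>undefined\<close> off the carriers, just as the restricted composites are.\<close>
  show "comp_functor C F (id_functor C) = F"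
    using on_obj on_arr
    by (auto simp: comp_functor_def id_functor_def PiE_def compose_Id)
  show "comp_functor C (id_functor D) F = F"
    using on_obj on_arr
    by (auto simp: comp_functor_def id_functor_def PiE_def Id_compose)
next
  fix C D E B :: "('o, 'm) category_data" and F F' F''
  assume "category_functor C D F"
  then interpret category_functor C D F .
  \<comment> \<open>\<open>F\<close> lands in the carriers of \<open>D\<close>, so the restriction
    inside \<open>comp_functor D F'' F'\<close> is never felt.\<close>
  show "comp_functor C F'' (comp_functor C F' F) = comp_functor C (comp_functor D F'' F') F"
    using on_obj on_arr by (auto simp: comp_functor_def PiE_def compose_assoc)
qed

lemma category_Gph: "category Gph"
  unfolding Gph_def
proof (rule category_maps_category; clarsimp)
  fix G :: "'a pair_pre_digraph" assume "pair_sym_digraph G"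
  then interpret pair_sym_digraph G .
  \<comment> \<open>Well-formedness puts both ends of an arc among the vertices, where the
    restricted map is the identity.\<close>
  show "(\<lambda>v\<in>pverts G. v) \<in> graph_morphisms G G"
    by (auto simp: graph_morphisms_def dest: in_arcsD1 in_arcsD2)
next
  fix G H K :: "'a pair_pre_digraph" and \<phi> \<psi>
  assume "pair_sym_digraph G" and maps: "\<phi> \<in> graph_morphisms G H" "\<psi> \<in> graph_morphisms H K"
  then interpret pair_sym_digraph G by simp
  show "compose (pverts G) \<psi> \<phi> \<in> graph_morphisms G K"
    using maps
    by (auto simp: graph_morphisms_def compose_eq PiE_iff) (metis compose_eq in_arcsD1 in_arcsD2)
next
  fix G H :: "'a pair_pre_digraph" and \<phi> assume "\<phi> \<in> graph_morphisms G H"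
  then show "compose (pverts G) \<phi> (\<lambda>v\<in>pverts G. v) = \<phi>" "compose (pverts G) (\<lambda>v\<in>pverts H. v) \<phi> = \<phi>"
    by (auto simp: graph_morphisms_def PiE_def compose_Id Id_compose)
qed (auto simp: graph_morphisms_def PiE_def compose_assoc)

section \<open>Prune equivalence\<close>

lemma vwalk_singleton_iff: "vwalk [u] G \<longleftrightarrow> u \<in> verts G"
  by (auto simp: vwalk_def)

lemma vwalk_Cons_Cons_iff:
  "vwalk (u # v # p) G \<longleftrightarrow> u \<in> verts G \<and> (u, v) \<in> arcs_ends G \<and> vwalk (v # p) G"
  by (auto simp: vwalk_def)

text \<open>Keeping the cut vertex \<open>u\<close> in both halves distributes the arcs without
  loss. Cutting and regluing in this way removes a detour between two copies of
  \<open>u\<close>.\<close>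

lemma vwalk_append_Cons_iff:
  "vwalk (p @ u # q) G \<longleftrightarrow> vwalk (p @ [u]) G \<and> vwalk (u # q) G"
  by (cases "p = []") (auto simp: vwalk_def vwalk_arcs_append)

text \<open>The detour leaves \<open>u\<close> and returns to it, and one copy of \<open>u\<close>
  survives; it is the first or last entry even if \<open>xs\<close> or \<open>ys\<close> is
  empty.\<close>

lemma prune_invariants:
  assumes "prune G p q"
  shows "vwalk p (with_proj G)" "vwalk q (with_proj G)" "hd q = hd p" "last q = last p"
proof -
  from assms obtain xs u v ys
    where "p = xs @ u # v # u # ys" "q = xs @ u # ys" "vwalk p (with_proj G)"
    by cases metis
  then show "vwalk p (with_proj G)" "vwalk q (with_proj G)" "hd q = hd p" "last q = last p"
    using vwalk_append_Cons_iff [of xs u "v # u # ys" "with_proj G"]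
      vwalk_append_Cons_iff [of xs u ys "with_proj G"]
    by (auto simp: vwalk_Cons_Cons_iff hd_append)
qed

text \<open>As \<open>equivclp\<close> is reflexive on arbitrary lists, \<open>p\<close> is required
  to be a walk; a generating step, in either direction, has walks with common ends on both
  sides.\<close>

lemma equivclp_prune_invariants:
  assumes "equivclp (prune G) p q" "vwalk p (with_proj G)"
  shows "vwalk q (with_proj G) \<and> hd q = hd p \<and> last q = last p"
  using assms by (induction rule: equivclp_induct) (auto dest: prune_invariants)

section \<open>Prunes and concatenation\<close>

lemma prune_append:
  assumes "prune G p q" "vwalk (xs @ p @ ys) (with_proj G)"
  shows "prune G (xs @ p @ ys) (xs @ q @ ys)"
  using assms(1)
proof cases
  case (1 as u v bs)
  then show ?thesis
    using prune.intros [of "xs @ as" u v "bs @ ys" G] assms(2) by simp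
qed

lemma prune_join_left:
  assumes "prune G p p'" "vwalk q (with_proj G)" "last p = hd q"
  shows "prune G (p \<oplus> q) (p' \<oplus> q)"
  using prune_append [OF assms(1), of "[]" "tl q"] vwalk_joinI_vwalk' [of p "with_proj G" q]
    prune_invariants [OF assms(1)] assms(2,3)
  by (simp add: vwalk_join_def)

lemma prune_join_right:
  assumes "prune G q q'" "vwalk p (with_proj G)" "last p = hd q"
  shows "prune G (p \<oplus> q) (p \<oplus> q')"
proof -
  \<comment> \<open>The defining form \<open>p @ tl q\<close> cuts off the head of \<open>q\<close>,
    which the prune may involve. Dropping the last entry of \<open>p\<close> instead keeps
    \<open>q\<close> whole, and \<open>q'\<close> too, since it has the same head.\<close>
  have "p \<oplus> r = butlast p @ r @ []" if "r \<noteq> []" "hd r = hd q" for r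
    using that assms(2,3) by (simp add: vwalk_join_def2 joinable_def vwalk_def)
  moreover have "vwalk (p \<oplus> q) (with_proj G)"
    using assms by (auto intro: vwalk_joinI_vwalk' dest: prune_invariants)
  ultimately show ?thesis
    using prune_append [OF assms(1), of "butlast p" "[]"] prune_invariants [OF assms(1)]
    by (auto simp: vwalk_def)
qed

text \<open>One factor is replaced at a time, first \<open>p\<close> and then \<open>q\<close>;
  invariance of the ends keeps the walks joinable at every intermediate stage.\<close>

lemma equivclp_prune_join:
  assumes "equivclp (prune G) p p'" "equivclp (prune G) q q'"
    and "vwalk p (with_proj G)" "vwalk q (with_proj G)" "last p = hd q"
  shows "equivclp (prune G) (p \<oplus> q) (p' \<oplus> q')"
proof -
  have "equivclp (prune G) (p \<oplus> q) (p' \<oplus> q)"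
    using assms(1)
  proof (induction rule: equivclp_induct)
    case (step y z)
    \<comment> \<open>A generating step may be a prune of \<open>y\<close> or of \<open>z\<close>,
      so both must be joinable with \<open>q\<close>.\<close>
    have "last y = hd q" "last z = hd q"
      using step.hyps assms(3,5) equivclp_prune_invariants [OF step.hyps(1) assms(3)]
      by (auto dest: prune_invariants)
    with step show ?case
      by (meson assms(4) equivclp_into_equivclp prune_join_left)
  qed simp
  also have "equivclp (prune G) (p' \<oplus> q) (p' \<oplus> q')"
    using assms(2)
  proof (induction rule: equivclp_induct)
    case (step y z)
    have p': "vwalk p' (with_proj G)" "last p' = hd q"
      using equivclp_prune_invariants [OF assms(1,3)] assms(5) by auto
    then have "last p' = hd y" "last p' = hd z"
      using step.hyps equivclp_prune_invariants [OF step.hyps(1) assms(4)]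
      by (auto dest: prune_invariants)
    with step p' show ?case
      by (meson equivclp_into_equivclp prune_join_right)
  qed simp
  finally show ?thesis .
qed

text \<open>Induction from the start of the walk: the part behind the first edge, traversed there
  and back, contracts to \<open>[v]\<close>, and the remaining \<open>[u, v, u]\<close> is a single
  prune away from \<open>[u]\<close>.\<close>

lemma (in pair_sym_digraph) equivclp_prune_join_rev:
  assumes "vwalk p (with_proj G)"
  shows "equivclp (prune G) (p \<oplus> rev p) [hd p]"
  using assms
proof (induction p rule: induct_list012)
  case (3 u v q)
  define p where p: "p = v # q"
  then have uv: "(u, v) \<in> parcs G" "(v, u) \<in> parcs G" "u \<in> pverts G" "v \<in> pverts G"
    and vp: "vwalk p (with_proj G)"
    using 3(3) by (auto simp: vwalk_Cons_Cons_iff arcs_symmetric in_arcsD2)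
  then have IH: "equivclp (prune G) (p \<oplus> rev p) [v]"
    using "3.IH"(2) by (simp add: p)
  let ?r = "p \<oplus> rev p"
  \<comment> \<open>Transported from the trivial walk \<open>[v]\<close> along the equivalence
    \<open>IH\<close> read backwards.\<close>
  have r: "vwalk ?r (with_proj G)" "hd ?r = v" "last ?r = v"
    using equivclp_prune_invariants [OF equivclp_sym [OF IH]] uv p
    by (auto simp: vwalk_singleton_iff)
  have walks: "vwalk [u, v] (with_proj G)" "vwalk [v, u] (with_proj G)"
    using uv by (auto simp: vwalk_singleton_iff vwalk_Cons_Cons_iff)
  \<comment> \<open>The \<open>tl\<close> in \<open>\<oplus>\<close> removes the last entry of
    \<open>q\<close>, or \<open>v\<close> if \<open>q\<close> is empty; hence the case split at the
    right end.\<close>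
  have "(u # p) \<oplus> rev (u # p) = [u, v] \<oplus> (?r \<oplus> [v, u])"
    by (cases q rule: rev_cases) (simp_all add: p vwalk_join_def)
  also have "equivclp (prune G) \<dots> ([u, v] \<oplus> ([v] \<oplus> [v, u]))"
  proof (rule equivclp_prune_join)
    show "equivclp (prune G) (?r \<oplus> [v, u]) ([v] \<oplus> [v, u])"
      using IH walks r equivclp_prune_join [of G ?r "[v]" "[v, u]" "[v, u]"] by simp
    show "vwalk (?r \<oplus> [v, u]) (with_proj G)"
      using walks r by (simp add: vwalk_joinI_vwalk')
    show "last [u, v] = hd (?r \<oplus> [v, u])"
      using r by (simp add: vwalk_join_hd' p)
  qed (use walks in auto)
  also have "[u, v] \<oplus> ([v] \<oplus> [v, u]) = [u, v, u]"
    by (simp add: vwalk_join_def)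
  also have "equivclp (prune G) [u, v, u] [u]"
    using prune.intros [of "[]" u v "[]" G] uv
    by (auto simp: vwalk_singleton_iff vwalk_Cons_Cons_iff)
  finally show ?case by (simp add: p)
qed (auto simp: vwalk_join_def)

section \<open>Images of walks under graph morphisms\<close>

lemma graph_morphism_verts:
  "\<phi> \<in> graph_morphisms G H \<Longrightarrow> v \<in> pverts G \<Longrightarrow> \<phi> v \<in> pverts H"
  by (auto simp: graph_morphisms_def)

lemma graph_morphism_vwalk:
  assumes "\<phi> \<in> graph_morphisms G H" "vwalk p (with_proj G)"
  shows "vwalk (map \<phi> p) (with_proj H)"
  using assms(2,1)
  by (induction p rule: induct_list012)
    (auto simp: graph_morphisms_def vwalk_singleton_iff vwalk_Cons_Cons_iff)

text \<open>Any map keeps equal entries equal, so the repeated \<open>u\<close> becomes a repeated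
  \<open>\<phi> u\<close>; preservation of adjacency ensures that the image is still a walk.\<close>

lemma graph_morphism_prune:
  assumes "\<phi> \<in> graph_morphisms G H" "prune G p q"
  shows "prune H (map \<phi> p) (map \<phi> q)"
  using assms(2)
proof cases
  case (1 xs u v ys)
  then show ?thesis
    using prune.intros [of "map \<phi> xs" "\<phi> u" "\<phi> v" "map \<phi> ys" H] graph_morphism_vwalk [OF assms(1), of p]
    by simp
qed

lemma graph_morphism_equivclp_prune:
  assumes "\<phi> \<in> graph_morphisms G H" "equivclp (prune G) p q"
  shows "equivclp (prune H) (map \<phi> p) (map \<phi> q)"
  using assms(2)
  by (induction rule: equivclp_induct)
    (auto intro: equivclp_into_equivclp dest: graph_morphism_prune [OF assms(1)])

section \<open>Prune classes\<close>

lemma prune_class_eq_iff: "prune_class G p = prune_class G q \<longleftrightarrow> equivclp (prune G) p q"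
proof
  assume pq: "equivclp (prune G) p q"
  show "prune_class G p = prune_class G q"
    unfolding prune_class_def
    by (blast intro: equivclp_trans [OF pq] equivclp_trans [OF equivclp_sym [OF pq]])
next
  assume "prune_class G p = prune_class G q"
  moreover have "q \<in> prune_class G q"
    by (simp add: prune_class_def)
  ultimately have "q \<in> prune_class G p"
    by simp
  then show "equivclp (prune G) p q"
    by (simp add: prune_class_def)
qed

lemma mem_prune_class_iff: "q \<in> prune_class G p \<longleftrightarrow> equivclp (prune G) p q"
  by (simp add: prune_class_def)

lemma prune_classesE:
  assumes "c \<in> prune_classes G"
  obtains p where "vwalk p (with_proj G)" "c = prune_class G p"
  using assms by (auto simp: prune_classes_def)

lemma prune_class_in [simp]: "vwalk p (with_proj G) \<Longrightarrow> prune_class G p \<in> prune_classes G"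
  by (simp add: prune_classes_def)

lemma class_start_prune_class [simp]:
  "vwalk p (with_proj G) \<Longrightarrow> class_start (prune_class G p) = hd p"
  and class_end_prune_class [simp]:
  "vwalk p (with_proj G) \<Longrightarrow> class_end (prune_class G p) = last p"
proof -
  assume p: "vwalk p (with_proj G)"
  \<comment> \<open>\<open>the_elem\<close> is meaningful only on singletons, so the class must be
    nonempty and its ends constant.\<close>
  have ne: "prune_class G p \<noteq> {}"
    by (auto simp: prune_class_def intro: exI [of _ p])
  have ends: "hd q = hd p" "last q = last p" if "q \<in> prune_class G p" for q
    using equivclp_prune_invariants [OF _ p, of q] that by (auto simp: mem_prune_class_iff)
  show "class_start (prune_class G p) = hd p"
    unfolding class_start_def using ne ends(1) by (rule the_elem_image_unique)
  show "class_end (prune_class G p) = last p"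
    unfolding class_end_def using ne ends(2) by (rule the_elem_image_unique)
qed

text \<open>The common form of all well-definedness arguments: a union over representatives
  collapses once its members agree, \<open>p\<close> itself witnessing that there is one.\<close>

lemma UN_prune_class_const:
  assumes "\<And>p'. equivclp (prune G) p p' \<Longrightarrow> f p' = c"
  shows "(\<Union>p'\<in>prune_class G p. f p') = c"
proof -
  have "f p' = c" if "p' \<in> prune_class G p" for p'
    using that assms by (simp add: mem_prune_class_iff)
  moreover have "p \<in> prune_class G p"
    by (simp add: mem_prune_class_iff)
  ultimately show ?thesis by blast
qed

section \<open>The walk groupoid and its functoriality\<close>

lemma walk_groupoid_simps [simp]:
  "Obj (walk_groupoid G) = pverts G"
  "Arr (walk_groupoid G) = prune_classes G"
  "v \<in> pverts G \<Longrightarrow> Id (walk_groupoid G) v = prune_class G [v]"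
  "vwalk p (with_proj G) \<Longrightarrow> Dom (walk_groupoid G) (prune_class G p) = hd p"
  "vwalk p (with_proj G) \<Longrightarrow> Cod (walk_groupoid G) (prune_class G p) = last p"
  by (simp_all add: walk_groupoid_def)

text \<open>By \<open>equivclp_prune_join\<close> both unions collapse, so any representatives may
  be used. The order flips because arrows compose like functions while walks are read from left to
  right.\<close>

lemma Comp_walk_groupoid [simp]:
  assumes "vwalk p (with_proj G)" "vwalk q (with_proj G)" "last p = hd q"
  shows "Comp (walk_groupoid G) (prune_class G q) (prune_class G p) = prune_class G (p \<oplus> q)"
proof -
  have "(\<Union>p'\<in>prune_class G p. \<Union>q'\<in>prune_class G q. prune_class G (p' \<oplus> q')) =
      prune_class G (p \<oplus> q)"
    using assms
    by (intro UN_prune_class_const)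
      (simp add: prune_class_eq_iff equivclp_prune_join equivclp_sym)
  with assms show ?thesis
    by (simp add: walk_groupoid_def composable_def)
qed

text \<open>The ends of a class are those of each representative, so representatives of composable
  classes can be joined.\<close>

lemma composable_walk_groupoidE:
  assumes "composable (prune_classes G) (Dom (walk_groupoid G)) (Cod (walk_groupoid G)) d c"
  obtains p q where "vwalk p (with_proj G)" "vwalk q (with_proj G)" "last p = hd q"
    "c = prune_class G p" "d = prune_class G q"
  using assms by (auto simp: composable_def elim!: prune_classesE)

lemma vwalk_join_ends:
  assumes "vwalk p G" "vwalk q G" "last p = hd q"
  shows "hd (p \<oplus> q) = hd p" "last (p \<oplus> q) = last q"
  using assms vwalk_join_hd [of p q] vwalk_join_last [of p q] by (auto simp: joinable_def)

lemma vwalk_hd_last: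
  "vwalk p G \<Longrightarrow> hd p \<in> verts G" "vwalk p G \<Longrightarrow> last p \<in> verts G"
  by (auto simp: vwalk_def)

text \<open>Unit and associativity laws hold for vertex lists under \<open>\<oplus>\<close> before
  classes are taken; among the laws, only invertibility relies on pruning.\<close>

lemma groupoid_walk_groupoid:
  assumes "pair_sym_digraph G"
  shows "groupoid (walk_groupoid G)" (is "groupoid ?W")
proof -
  interpret pair_sym_digraph G by fact
  \<comment> \<open>Symmetry of adjacency enters here.\<close>
  have vwalk_rev: "vwalk (rev p) (with_proj G)" if "vwalk p (with_proj G)" for p
    using that by (auto simp: vwalk_def set_vwalk_arcs_rev arcs_symmetric)
  show ?thesis
  proof
    show "Dom ?W \<in> Arr ?W \<rightarrow>\<^sub>E Obj ?W" "Cod ?W \<in> Arr ?W \<rightarrow>\<^sub>E Obj ?W"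
      by (auto simp: walk_groupoid_def vwalk_hd_last elim!: prune_classesE)
         (auto dest: vwalk_hd_last)
    show "Id ?W \<in> Obj ?W \<rightarrow>\<^sub>E Arr ?W"
      by (auto simp: walk_groupoid_def vwalk_singleton_iff)
  next
    fix d c assume "\<not> composable (Arr ?W) (Dom ?W) (Cod ?W) d c"
    then show "Comp ?W d c = undefined"
      by (auto simp: walk_groupoid_def composable_def)
  next
    fix c assume "c \<in> Arr ?W"
    then obtain p where p: "vwalk p (with_proj G)" "c = prune_class G p"
      by (auto elim: prune_classesE)
    then have "p \<noteq> []" by auto
    show "Comp ?W c (Id ?W (Dom ?W c)) = c" "Comp ?W (Id ?W (Cod ?W c)) c = c"
      using p vwalk_hd_last [OF p(1)] \<open>p \<noteq> []\<close>
      by (simp_all add: vwalk_singleton_iff) (simp_all add: vwalk_join_def)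
    \<comment> \<open>The inverse is the class of \<open>rev p\<close>: contracting
      \<open>p \<oplus> rev p\<close> gives one identity, and the same contraction for
      \<open>rev p\<close> gives the other.\<close>
    have "hd (rev p) = last p" "last (rev p) = hd p"
      using \<open>p \<noteq> []\<close> by (simp_all add: hd_rev last_rev)
    then show "\<exists>d\<in>Arr ?W. Dom ?W d = Cod ?W c \<and> Cod ?W d = Dom ?W c \<and>
        Comp ?W d c = Id ?W (Dom ?W c) \<and> Comp ?W c d = Id ?W (Cod ?W c)"
      using p vwalk_hd_last [OF p(1)] vwalk_rev [OF p(1)]
        equivclp_prune_join_rev [OF p(1)] equivclp_prune_join_rev [OF vwalk_rev [OF p(1)]]
      by (intro bexI [of _ "prune_class G (rev p)"]) (simp_all add: prune_class_eq_iff)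
  next
    fix d c e
    assume "composable (Arr ?W) (Dom ?W) (Cod ?W) d c" "composable (Arr ?W) (Dom ?W) (Cod ?W) e d"
    then obtain p q r where "vwalk p (with_proj G)" "vwalk q (with_proj G)" "vwalk r (with_proj G)"
      "last p = hd q" "last q = hd r" "c = prune_class G p" "d = prune_class G q"
      "e = prune_class G r"
      by (auto simp: composable_def elim!: prune_classesE)
    \<comment> \<open>With an empty middle list, \<open>tl\<close> would cut into the third list and
      associativity of \<open>\<oplus>\<close> could fail.\<close>
    moreover from this have "p \<noteq> []" "q \<noteq> []" by auto
    ultimately show "Comp ?W e (Comp ?W d c) = Comp ?W (Comp ?W e d) c"
      by (simp add: vwalk_joinI_vwalk' vwalk_join_ends vwalk_join_assoc')
  qed (auto elim!: composable_walk_groupoidE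
      simp: vwalk_singleton_iff vwalk_joinI_vwalk' vwalk_join_ends)
qed

section \<open>The functor induced by a graph morphism\<close>

lemma induced_map_on_obj: "v \<in> pverts G \<Longrightarrow> on_obj (induced_map G H \<phi>) v = \<phi> v"
  by (simp add: induced_map_def)

text \<open>The union is constant because \<open>\<phi>\<close> preserves prune equivalence.\<close>

lemma induced_map_on_arr:
  assumes "\<phi> \<in> graph_morphisms G H" "vwalk p (with_proj G)"
  shows "on_arr (induced_map G H \<phi>) (prune_class G p) = prune_class H (map \<phi> p)"
proof -
  have "(\<Union>p'\<in>prune_class G p. prune_class H (map \<phi> p')) = prune_class H (map \<phi> p)"
    using assms(1)
    by (intro UN_prune_class_const)
      (simp add: prune_class_eq_iff graph_morphism_equivclp_prune equivclp_sym)
  with assms(2) show ?thesis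
    by (simp add: induced_map_def)
qed

text \<open>On nonempty lists \<open>map\<close> commutes with \<open>hd\<close>,
  \<open>last\<close> and \<open>\<oplus>\<close>, so each functor law is read off
  representatives.\<close>

lemma category_functor_induced_map:
  assumes "pair_sym_digraph G" "pair_sym_digraph H" and \<phi>: "\<phi> \<in> graph_morphisms G H"
  shows "category_functor (walk_groupoid G) (walk_groupoid H) (induced_map G H \<phi>)"
proof -
  interpret G: groupoid "walk_groupoid G" using assms by (intro groupoid_walk_groupoid)
  interpret H: groupoid "walk_groupoid H" using assms by (intro groupoid_walk_groupoid)
  note [simp] = induced_map_on_obj induced_map_on_arr [OF \<phi>] graph_morphism_vwalk [OF \<phi>]
    vwalk_singleton_iff
  show ?thesis
  proof
    show "on_obj (induced_map G H \<phi>) \<in> Obj (walk_groupoid G) \<rightarrow>\<^sub>E Obj (walk_groupoid H)"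
      using graph_morphism_verts [OF \<phi>] by (auto simp: induced_map_def)
    show "on_arr (induced_map G H \<phi>) \<in> Arr (walk_groupoid G) \<rightarrow>\<^sub>E Arr (walk_groupoid H)"
    proof (rule PiE_I)
      fix c assume "c \<in> Arr (walk_groupoid G)"
      then show "on_arr (induced_map G H \<phi>) c \<in> Arr (walk_groupoid H)"
        by (auto elim: prune_classesE)
    qed (simp add: induced_map_def)
  next
    fix c assume "c \<in> Arr (walk_groupoid G)"
    then obtain p where p: "vwalk p (with_proj G)" "c = prune_class G p"
      by (auto elim: prune_classesE)
    moreover from this have "p \<noteq> []" by auto
    ultimately show
      "Dom (walk_groupoid H) (on_arr (induced_map G H \<phi>) c) =
        on_obj (induced_map G H \<phi>) (Dom (walk_groupoid G) c)"
      "Cod (walk_groupoid H) (on_arr (induced_map G H \<phi>) c) =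
        on_obj (induced_map G H \<phi>) (Cod (walk_groupoid G) c)"
      using vwalk_hd_last [OF p(1)] by (simp_all add: hd_map last_map)
  next
    fix d c
    assume "composable (Arr (walk_groupoid G)) (Dom (walk_groupoid G)) (Cod (walk_groupoid G)) d c"
    then obtain p q where "vwalk p (with_proj G)" "vwalk q (with_proj G)" "last p = hd q"
      "c = prune_class G p" "d = prune_class G q"
      by (auto elim: composable_walk_groupoidE)
    moreover from this have "p \<noteq> []" "q \<noteq> []" by auto
    moreover have "map \<phi> (p \<oplus> q) = map \<phi> p \<oplus> map \<phi> q"
      by (simp add: vwalk_join_def map_tl)
    ultimately show "on_arr (induced_map G H \<phi>) (Comp (walk_groupoid G) d c) =
        Comp (walk_groupoid H) (on_arr (induced_map G H \<phi>) d) (on_arr (induced_map G H \<phi>) c)"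
      by (simp add: vwalk_joinI_vwalk' hd_map last_map)
  qed (auto simp: graph_morphism_verts [OF \<phi>])
qed

text \<open>Functor data is \<open>undefined\<close> off the carriers and every arrow is the class
  of a walk, so these tests suffice.\<close>

lemma walk_groupoid_functor_eqI:
  assumes "category_functor (walk_groupoid G) D F" "category_functor (walk_groupoid G) D F'"
    and "\<And>v. v \<in> pverts G \<Longrightarrow> on_obj F v = on_obj F' v"
    and "\<And>p. vwalk p (with_proj G) \<Longrightarrow>
      on_arr F (prune_class G p) = on_arr F' (prune_class G p)"
  shows "F = F'"
proof -
  interpret F: category_functor "walk_groupoid G" D F by fact
  interpret F': category_functor "walk_groupoid G" D F' by fact
  have "on_obj F = on_obj F'"
    using F.on_obj F'.on_obj assms(3) by (intro PiE_ext) auto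
  moreover have "on_arr F = on_arr F'"
    using F.on_arr F'.on_arr assms(4) by (intro PiE_ext) (auto elim!: prune_classesE)
  ultimately show ?thesis by simp
qed

text \<open>All entries of a walk are vertices. This removes the restrictions carried by identities
  and composites in \<open>Gph\<close>.\<close>

lemma map_restrict_vwalk: "vwalk p G \<Longrightarrow> map (\<lambda>v\<in>verts G. f v) p = map f p"
  by (auto simp: vwalk_def)

lemma induced_map_id:
  assumes "pair_sym_digraph G" "(\<lambda>v\<in>pverts G. v) \<in> graph_morphisms G G"
  shows "induced_map G G (\<lambda>v\<in>pverts G. v) = id_functor (walk_groupoid G)"
proof (rule walk_groupoid_functor_eqI)
  show "category_functor (walk_groupoid G) (walk_groupoid G) (id_functor (walk_groupoid G))"
    using assms by (intro category_functor_id_functor groupoid.axioms groupoid_walk_groupoid)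
  fix p assume "vwalk p (with_proj G)"
  with assms(2) map_restrict_vwalk [OF this, of "\<lambda>v. v"]
  show "on_arr (induced_map G G (\<lambda>v\<in>pverts G. v)) (prune_class G p) =
      on_arr (id_functor (walk_groupoid G)) (prune_class G p)"
    by (simp add: induced_map_on_arr id_functor_def)
qed (use assms in \<open>auto simp: category_functor_induced_map induced_map_on_obj id_functor_def\<close>)

text \<open>On a walk, the restricted composite acts entrywise as \<open>\<phi>\<close> followed by
  \<open>\<psi>\<close>.\<close>

lemma induced_map_compose:
  assumes "pair_sym_digraph G" "pair_sym_digraph H" "pair_sym_digraph K"
    and \<phi>: "\<phi> \<in> graph_morphisms G H" and \<psi>: "\<psi> \<in> graph_morphisms H K"
    and \<psi>\<phi>: "compose (pverts G) \<psi> \<phi> \<in> graph_morphisms G K"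
  shows "induced_map G K (compose (pverts G) \<psi> \<phi>) =
    comp_functor (walk_groupoid G) (induced_map H K \<psi>) (induced_map G H \<phi>)"
proof (rule walk_groupoid_functor_eqI)
  show "category_functor (walk_groupoid G) (walk_groupoid K)
      (comp_functor (walk_groupoid G) (induced_map H K \<psi>) (induced_map G H \<phi>))"
    using assms
    by (intro category_functor_comp_functor [OF category_functor_induced_map
          category_functor_induced_map])
  fix p assume p: "vwalk p (with_proj G)"
  then have map_eq: "map (compose (pverts G) \<psi> \<phi>) p = map \<psi> (map \<phi> p)"
    using map_restrict_vwalk [OF p, of "\<psi> \<circ> \<phi>"] by (simp add: compose_def comp_def)
  show "on_arr (induced_map G K (compose (pverts G) \<psi> \<phi>)) (prune_class G p) =
      on_arr (comp_functor (walk_groupoid G) (induced_map H K \<psi>) (induced_map G H \<phi>))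
        (prune_class G p)"
    using p graph_morphism_vwalk [OF \<phi> p] arg_cong [OF map_eq, of "prune_class K"]
    by (simp add: comp_functor_def compose_eq induced_map_on_arr [OF \<phi>]
        induced_map_on_arr [OF \<psi>] induced_map_on_arr [OF \<psi>\<phi>])
next
  fix v assume "v \<in> pverts G"
  then show "on_obj (induced_map G K (compose (pverts G) \<psi> \<phi>)) v =
      on_obj (comp_functor (walk_groupoid G) (induced_map H K \<psi>) (induced_map G H \<phi>)) v"
    using graph_morphism_verts [OF \<phi>]
    by (simp add: induced_map_on_obj comp_functor_def compose_eq)
qed (use assms in \<open>simp add: category_functor_induced_map\<close>)

section \<open>Assembly of the functor on \<open>Gph\<close>\<close>

lemma Obj_Gph: "Obj Gph = Collect pair_sym_digraph"
  by (simp add: Gph_def)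

lemma Arrow_in_Gph: "Arrow G \<phi> H \<in> Arr Gph \<longleftrightarrow>
    pair_sym_digraph G \<and> pair_sym_digraph H \<and> \<phi> \<in> graph_morphisms G H"
  by (simp add: Gph_def)

lemma category_functor_walk_groupoid_functor:
  "category_functor
    (Gph :: ('a pair_pre_digraph, ('a pair_pre_digraph, 'a \<Rightarrow> 'a) arrow) category_data)
    Groupoids walk_groupoid_functor" (is "category_functor ?Gph ?Groupoids ?F")
proof -
  interpret Gph: category ?Gph by (rule category_Gph)
  interpret Groupoids: category ?Groupoids by (rule category_Groupoids)
  have on_arr: "on_arr ?F (Arrow G \<phi> H) =
      Arrow (walk_groupoid G) (induced_map G H \<phi>) (walk_groupoid H)"
    and on_arr_in: "Arrow (walk_groupoid G) (induced_map G H \<phi>) (walk_groupoid H) \<in> Arr ?Groupoids"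
    if "Arrow G \<phi> H \<in> Arr ?Gph" for G \<phi> H
    using that
    by (auto simp: walk_groupoid_functor_def Groupoids_def Arrow_in_Gph
        category_functor_induced_map groupoid_walk_groupoid)
  have on_obj: "on_obj ?F G = walk_groupoid G"
    if "pair_sym_digraph G" for G
    using that by (simp add: walk_groupoid_functor_def Obj_Gph)
  show ?thesis
  proof
    show "on_obj ?F \<in> Obj ?Gph \<rightarrow>\<^sub>E Obj ?Groupoids"
      by (auto simp: walk_groupoid_functor_def Obj_Gph Groupoids_def groupoid_walk_groupoid)
    show "on_arr ?F \<in> Arr ?Gph \<rightarrow>\<^sub>E Arr ?Groupoids"
    proof (rule PiE_I)
      fix a assume "a \<in> Arr ?Gph"
      then show "on_arr ?F a \<in> Arr ?Groupoids"
        using on_arr on_arr_in by (cases a) auto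
    qed (simp add: walk_groupoid_functor_def)
  next
    fix a assume a: "a \<in> Arr ?Gph"
    then obtain G \<phi> H where [simp]: "a = Arrow G \<phi> H"
      and "pair_sym_digraph G" "pair_sym_digraph H"
      by (cases a) (auto simp: Arrow_in_Gph)
    moreover from a have "Dom ?Gph a = G" "Cod ?Gph a = H"
      by (simp_all add: Gph_def)
    ultimately show "Dom ?Groupoids (on_arr ?F a) = on_obj ?F (Dom ?Gph a)"
      "Cod ?Groupoids (on_arr ?F a) = on_obj ?F (Cod ?Gph a)"
      using a on_arr_in [of G \<phi> H]
      by (simp_all add: on_arr on_obj) (simp_all add: Groupoids_def)
  next
    fix G assume "G \<in> Obj ?Gph"
    \<comment> \<open>\<open>induced_map_id\<close> asks for the identity to be a graph morphism,
      which the category axioms of \<open>Gph\<close> supply.\<close>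
    moreover from this have "Arrow G (\<lambda>v\<in>pverts G. v) G \<in> Arr ?Gph"
      using Gph.Id_in [of G] by (simp add: Gph_def)
    ultimately show "on_arr ?F (Id ?Gph G) = Id ?Groupoids (on_obj ?F G)"
      using on_arr [of G "\<lambda>v\<in>pverts G. v" G]
      by (simp add: on_obj Obj_Gph Arrow_in_Gph induced_map_id)
        (simp add: Gph_def Groupoids_def groupoid_walk_groupoid)
  next
    fix b a assume ba: "composable (Arr ?Gph) (Dom ?Gph) (Cod ?Gph) b a"
    then obtain G \<phi> H \<psi> K where [simp]: "a = Arrow G \<phi> H" "b = Arrow H \<psi> K"
      unfolding Gph_def by (elim composable_maps_categoryE)
    from ba have arr: "Arrow G \<phi> H \<in> Arr ?Gph" "Arrow H \<psi> K \<in> Arr ?Gph"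
      by (simp_all add: composable_def)
    then have comp: "Comp ?Gph (Arrow H \<psi> K) (Arrow G \<phi> H) = Arrow G (compose (pverts G) \<psi> \<phi>) K"
      by (simp add: Gph_def)
    \<comment> \<open>Likewise, closure of \<open>Gph\<close> under composition makes the composite
      a graph morphism, as \<open>induced_map_compose\<close> demands.\<close>
    with Gph.Comp_in_Arr [OF ba] arr
    have "Arrow G (compose (pverts G) \<psi> \<phi>) K \<in> Arr ?Gph" by simp
    with arr on_arr_in [OF arr(1)] on_arr_in [OF arr(2)]
    show "on_arr ?F (Comp ?Gph b a) = Comp ?Groupoids (on_arr ?F b) (on_arr ?F a)"
      by (simp add: comp on_arr Arrow_in_Gph induced_map_compose [of G H K])
        (simp add: Groupoids_def)
  qed
qed

text \<open>The last two conjuncts record the action on vertices and on representing walks, which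
  the definition of \<open>induced_map\<close> by unions leaves implicit.\<close>

theorem theorem3p9:
  shows "category_functor
      (Gph :: ('a pair_pre_digraph, ('a pair_pre_digraph, 'a \<Rightarrow> 'a) arrow) category_data)
      (Groupoids :: (('a, 'a list set) category_data,
        (('a, 'a list set) category_data, ('a, 'a list set, 'a, 'a list set) functor_data) arrow)
        category_data)
      walk_groupoid_functor \<and>
    (\<forall>(G :: 'a pair_pre_digraph) H \<phi> v. Arrow G \<phi> H \<in> Arr Gph \<longrightarrow> v \<in> pverts G \<longrightarrow>
      on_obj (induced_map G H \<phi>) v = \<phi> v) \<and>
    (\<forall>(G :: 'a pair_pre_digraph) H \<phi> p. Arrow G \<phi> H \<in> Arr Gph \<longrightarrow> vwalk p (with_proj G) \<longrightarrow>
      on_arr (induced_map G H \<phi>) (prune_class G p) = prune_class H (map \<phi> p))"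
  by (simp add: category_functor_walk_groupoid_functor Arrow_in_Gph induced_map_on_obj
      induced_map_on_arr)

end
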